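(* If $K$ is the limit of an inverse system of simple extensions, then $K$ has the finitely supported Josefson--Nissenzweig property.
   Context: All compact spaces are Hausdorff. An inverse system $\langle K_\alpha,\pi_\alpha^\beta\colon\alpha\le\beta\le\delta\rangle$ (with $\delta$ an ordinal and $\pi_\alpha^\beta\colon K_\beta\to K_\alpha$ continuous bonding maps) of totally disconnected compact spaces is a system of simple extensions if: (i) it is continuous, i.e. for every limit ordinal $\gamma\le\delta$ the space $K_\gamma$ is the limit of the inverse system $\langle K_\alpha,\pi_\alpha^\beta\colon\alpha\le\beta<\gamma\rangle$ (with $\pi_\alpha^\gamma$ the canonical projections); (ii) $K_0=2^\omega$ and each $K_\alpha$ is perfect, i.e. has no isolated points; (iii) for every $\alpha<\delta$ the space $K_{\alpha+1}$ is a simple extension of $K_\alpha$, i.e. there is $x_\alpha\in K_\alpha$ such that $|(\pi_\alpha^{\alpha+1})^{-1}(x_\alpha)|=2$ and $|(\pi_\alpha^{\alpha+1})^{-1}(y)|=1$ for every $y\in K_\alpha\setminus\{x_\alpha\}$. The limit of such a system is $K_\delta$. A compact space $K$ has the finitely supported Josefson--Nissenzweig property (fsJNP) if there is a sequence $\langle\mu_n\colon n\in\omega\rangle$ of finitely supported signed Radon measures on $K$ such that $\|\mu_n\|=1$ (total variation norm) for all $n$ and $\lim_n\int_K f\,d\mu_n=0$ for every $f\in C(K)$. *)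

theory Defs
  imports "HOL-Analysis.Analysis"
begin

section \<open>Ordinal indices\<close>

text \<open>
  An ordinal \<open>\<delta>\<close> is an element of an arbitrary type of class \<open>wellorder\<close>; it stands for the
  order type of \<open>{..<\<delta>}\<close>, and a system indexed by the ordinals \<open>\<alpha> \<le> \<delta>\<close> is indexed by \<open>{..\<delta>}\<close>.
\<close>

definition ord_zero :: "'i::wellorder" where
  "ord_zero = (LEAST a. True)"

text \<open>Meaningful only for elements that are not maximal; it is used below for \<open>\<alpha> < \<delta>\<close>.\<close>

definition ord_succ :: "'i::wellorder \<Rightarrow> 'i" where
  "ord_succ a = (LEAST b. a < b)"

definition ord_limit :: "'i::wellorder \<Rightarrow> bool" where
  "ord_limit g \<longleftrightarrow> (\<exists>a. a < g) \<and> (\<forall>a<g. \<exists>b. a < b \<and> b < g)"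


section \<open>Inverse systems of simple extensions\<close>

definition totally_disconnected_space :: "'a topology \<Rightarrow> bool" where
  "totally_disconnected_space X \<longleftrightarrow> (\<forall>S. connectedin X S \<longrightarrow> (\<exists>a. S \<subseteq> {a}))"

definition no_isolated_points :: "'a topology \<Rightarrow> bool" where
  "no_isolated_points X \<longleftrightarrow> (\<forall>x\<in>topspace X. \<not> openin X {x})"

definition cantor_space :: "(nat \<Rightarrow> bool) topology" where
  "cantor_space = product_topology (\<lambda>_. discrete_topology UNIV) UNIV"

text \<open>The bonding map from \<open>K b\<close> to \<open>K a\<close> is \<open>p a b\<close>.\<close>

definition inverse_system ::
    "'i::wellorder \<Rightarrow> ('i \<Rightarrow> 'a topology) \<Rightarrow> ('i \<Rightarrow> 'i \<Rightarrow> 'a \<Rightarrow> 'a) \<Rightarrow> bool" where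
  "inverse_system d K p \<longleftrightarrow>
     (\<forall>a b. a \<le> b \<and> b \<le> d \<longrightarrow> continuous_map (K b) (K a) (p a b)) \<and>
     (\<forall>a\<le>d. \<forall>x\<in>topspace (K a). p a a x = x) \<and>
     (\<forall>a b c. a \<le> b \<and> b \<le> c \<and> c \<le> d \<longrightarrow>
        (\<forall>x\<in>topspace (K c). p a b (p b c x) = p a c x))"

definition inverse_limit ::
    "'i::wellorder set \<Rightarrow> ('i \<Rightarrow> 'a topology) \<Rightarrow> ('i \<Rightarrow> 'i \<Rightarrow> 'a \<Rightarrow> 'a) \<Rightarrow> ('i \<Rightarrow> 'a) topology" where
  "inverse_limit I K p =
     subtopology (product_topology K I) {t. \<forall>a\<in>I. \<forall>b\<in>I. a \<le> b \<longrightarrow> p a b (t b) = t a}"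

text \<open>
  \<open>K g\<close> is the limit of the system below \<open>g\<close>, with the maps \<open>p a g\<close> as canonical projections:
  jointly they identify \<open>K g\<close> with the space of threads.
\<close>

definition continuous_inverse_system ::
    "'i::wellorder \<Rightarrow> ('i \<Rightarrow> 'a topology) \<Rightarrow> ('i \<Rightarrow> 'i \<Rightarrow> 'a \<Rightarrow> 'a) \<Rightarrow> bool" where
  "continuous_inverse_system d K p \<longleftrightarrow>
     (\<forall>g\<le>d. ord_limit g \<longrightarrow>
        homeomorphic_map (K g) (inverse_limit {..<g} K p) (\<lambda>x. \<lambda>a\<in>{..<g}. p a g x))"

text \<open>\<open>Y\<close> is a simple extension of \<open>X\<close> through the map \<open>f\<close> from \<open>Y\<close> to \<open>X\<close>.\<close>

definition simple_extension :: "'a topology \<Rightarrow> 'b topology \<Rightarrow> ('b \<Rightarrow> 'a) \<Rightarrow> bool" where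
  "simple_extension X Y f \<longleftrightarrow>
     (\<exists>x\<in>topspace X. card {z \<in> topspace Y. f z = x} = 2 \<and>
        (\<forall>y\<in>topspace X - {x}. card {z \<in> topspace Y. f z = y} = 1))"

definition system_of_simple_extensions ::
    "'i::wellorder \<Rightarrow> ('i \<Rightarrow> 'a topology) \<Rightarrow> ('i \<Rightarrow> 'i \<Rightarrow> 'a \<Rightarrow> 'a) \<Rightarrow> bool" where
  "system_of_simple_extensions d K p \<longleftrightarrow>
     inverse_system d K p \<and>
     (\<forall>a\<le>d. compact_space (K a) \<and> Hausdorff_space (K a) \<and> totally_disconnected_space (K a)) \<and>
     continuous_inverse_system d K p \<and>
     K ord_zero homeomorphic_space cantor_space \<and>
     (\<forall>a\<le>d. no_isolated_points (K a)) \<and>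
     (\<forall>a<d. simple_extension (K a) (K (ord_succ a)) (p a (ord_succ a)))"


section \<open>Signed Radon measures\<close>

definition borel_algebra :: "'a topology \<Rightarrow> 'a measure" where
  "borel_algebra X = sigma (topspace X) {U. openin X U}"

abbreviation borel_sets :: "'a topology \<Rightarrow> 'a set set" where
  "borel_sets X \<equiv> sets (borel_algebra X)"

text \<open>
  A signed measure is a real-valued set function; only its values on Borel sets matter.
\<close>

definition signed_borel_measure :: "'a topology \<Rightarrow> ('a set \<Rightarrow> real) \<Rightarrow> bool" where
  "signed_borel_measure X m \<longleftrightarrow>
     m {} = 0 \<and>
     (\<forall>A::nat \<Rightarrow> 'a set. range A \<subseteq> borel_sets X \<and> disjoint_family A \<longrightarrow>
        (\<lambda>n. m (A n)) sums m (\<Union>n. A n))"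

text \<open>The variation \<open>|m|\<close>, as a set function with values in \<open>[0,\<infinity>]\<close>.\<close>

definition variation :: "'a topology \<Rightarrow> ('a set \<Rightarrow> real) \<Rightarrow> 'a set \<Rightarrow> ennreal" where
  "variation X m A =
     (SUP P \<in> {P. finite P \<and> P \<subseteq> borel_sets X \<and> disjoint P \<and> \<Union>P = A}. \<Sum>B\<in>P. ennreal \<bar>m B\<bar>)"

definition total_variation_norm :: "'a topology \<Rightarrow> ('a set \<Rightarrow> real) \<Rightarrow> ennreal" where
  "total_variation_norm X m = variation X m (topspace X)"

text \<open>Compact sets are Borel in the Hausdorff spaces considered here.\<close>

definition signed_radon_measure :: "'a topology \<Rightarrow> ('a set \<Rightarrow> real) \<Rightarrow> bool" where
  "signed_radon_measure X m \<longleftrightarrow>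
     signed_borel_measure X m \<and>
     (\<forall>A\<in>borel_sets X. \<forall>e>0. \<exists>C. compactin X C \<and> C \<subseteq> A \<and> variation X m (A - C) < e)"

definition measure_support :: "'a topology \<Rightarrow> ('a set \<Rightarrow> real) \<Rightarrow> 'a set" where
  "measure_support X m = {x \<in> topspace X. \<forall>U. openin X U \<and> x \<in> U \<longrightarrow> variation X m U > 0}"

definition finitely_supported :: "'a topology \<Rightarrow> ('a set \<Rightarrow> real) \<Rightarrow> bool" where
  "finitely_supported X m \<longleftrightarrow> finite (measure_support X m)"

text \<open>
  The positive part of the Jordan decomposition \<open>m = m\<^sup>+ - m\<^sup>-\<close>, where
  \<open>m\<^sup>+ A = sup {m B | B \<subseteq> A Borel}\<close> and \<open>m\<^sup>- = (-m)\<^sup>+\<close>.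
  The coercion \<open>ennreal\<close> sends negative numbers to 0, which is harmless since \<open>B = {}\<close> is allowed.
\<close>

definition positive_part :: "'a topology \<Rightarrow> ('a set \<Rightarrow> real) \<Rightarrow> 'a measure" where
  "positive_part X m =
     measure_of (topspace X) (borel_sets X)
       (\<lambda>A. SUP B \<in> {B \<in> borel_sets X. B \<subseteq> A}. ennreal (m B))"

definition signed_integral :: "'a topology \<Rightarrow> ('a set \<Rightarrow> real) \<Rightarrow> ('a \<Rightarrow> real) \<Rightarrow> real" where
  "signed_integral X m f =
     integral\<^sup>L (positive_part X m) f - integral\<^sup>L (positive_part X (\<lambda>A. - m A)) f"


section \<open>The finitely supported Josefson--Nissenzweig property\<close>

definition fsJNP :: "'a topology \<Rightarrow> bool" where
  "fsJNP X \<longleftrightarrow>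
     (\<exists>m :: nat \<Rightarrow> 'a set \<Rightarrow> real.
        (\<forall>n. signed_radon_measure X (m n) \<and> finitely_supported X (m n) \<and>
             total_variation_norm X (m n) = 1) \<and>
        (\<forall>f. continuous_map X euclideanreal f \<longrightarrow>
             (\<lambda>n. signed_integral X (m n) f) \<longlonglongrightarrow> 0))"

end

theory Submission
  imports Defs
begin

text \<open>
  Identify \<open>K ord_zero\<close> with the Cantor space of all sequences of letters \<open>True\<close>, \<open>False\<close>, and let
  \<open>q\<close> be the map from \<open>K \<delta>\<close> onto it. For every \<open>n\<close>, place an atom of mass \<open>\<plusminus>1 / 2\<^sup>n\<^sup>+\<^sup>1\<close> over the
  cylinder of each word of length \<open>n + 1\<close>, the sign depending on the last letter. These
  measures have norm 1. In \<open>K ord_zero\<close> they converge to 0, because the two atoms over a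
  cylinder of depth \<open>n\<close> approach each other. In \<open>K \<delta>\<close> the two atoms may stay far apart, but this
  happens over a small set of cylinders only.

  The point is that every simple extension splits a single point, and a point is null for
  the coin-tossing measure on the Cantor space. Consequently, if \<open>A\<close> and \<open>B\<close> are disjoint closed
  sets of \<open>K \<delta>\<close>, then the compact sets \<open>q ` A\<close> and \<open>q ` B\<close> meet in a null set, although transfinitely
  many points have been split: from a limit space one descends to an earlier space in which the
  images of \<open>A\<close> and \<open>B\<close> are still disjoint, from a successor to its predecessor after removing a
  cylinder of small measure from both; as ordinals are well-founded, finitely many such steps
  lead to \<open>K ord_zero\<close>. In combinatorial form, the fraction of the words of length \<open>n\<close> whose
  cylinders meet both \<open>q ` A\<close> and \<open>q ` B\<close> tends to 0; this is \<open>negligible_overlap_to_cantor\<close>, proved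
  by transfinite induction along the system. Applied to sublevel and superlevel sets of a continuous
  function \<open>f\<close>, it shows that \<open>f\<close> has small oscillation over most cylinders of depth \<open>n\<close>, so
  that the integrals of \<open>f\<close> tend to 0 (\<open>fsJNP_if_negligible_overlaps\<close>).

  What remains is the surjectivity of \<open>q\<close>, again by transfinite induction
  (\<open>bonding_to_zero_onto\<close>), and the computation of norm and integral for finitely supported
  measures.
\<close>

section \<open>Chains of closed sets in compact spaces\<close>

lemma compact_chain_nonempty_Inter:
  fixes E :: "'i::linorder \<Rightarrow> 'a set"
  assumes "compact_space X" "I \<noteq> {}"
    and closed: "\<And>i. i \<in> I \<Longrightarrow> closedin X (E i)"
    and nonempty: "\<And>i. i \<in> I \<Longrightarrow> E i \<noteq> {}"
    and antitone: "\<And>i j. i \<in> I \<Longrightarrow> j \<in> I \<Longrightarrow> i \<le> j \<Longrightarrow> E j \<subseteq> E i"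
  shows "(\<Inter>i\<in>I. E i) \<noteq> {}"
proof -
  have "\<Inter>F \<noteq> {}" if "finite F" "F \<subseteq> E ` I" for F
  proof (cases "F = {}")
    case False
    obtain J where J: "J \<subseteq> I" "finite J" "F = E ` J"
      using finite_subset_image[OF \<open>finite F\<close> \<open>F \<subseteq> E ` I\<close>] by blast
    with False have "J \<noteq> {}" by auto
    then have "Max J \<in> J" using J by simp
    moreover have "E (Max J) \<subseteq> E j" if "j \<in> J" for j
      using antitone[of j "Max J"] J that \<open>Max J \<in> J\<close> Max_ge by blast
    ultimately have "E (Max J) \<subseteq> \<Inter>F" using J by auto
    then show ?thesis
      using nonempty J \<open>Max J \<in> J\<close> by blast
  qed auto
  moreover have "\<forall>C\<in>E ` I. closedin X C" using closed by simp
  ultimately show ?thesis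
    using \<open>compact_space X\<close>[unfolded compact_space_fip, rule_format, of "E ` I"] by simp
qed

text \<open>
  A failure at every index gives pairs in \<open>A \<times> B\<close> that are glued by \<open>f i\<close>. The sets of
  such pairs are compact and decrease with \<open>i\<close>, so some pair is glued by all the maps; it
  lies on the diagonal, which misses \<open>A \<times> B\<close>. This serves both the maps to
  initial words on the Cantor space and the projections of an inverse limit.
\<close>

lemma disjoint_closed_images_in_chain:
  fixes f :: "'i::linorder \<Rightarrow> 'a \<Rightarrow> 'b"
  assumes "compact_space X" "I \<noteq> {}"
    and Y: "\<And>i. i \<in> I \<Longrightarrow> Hausdorff_space (Y i)"
    and f: "\<And>i. i \<in> I \<Longrightarrow> continuous_map X (Y i) (f i)"
    and finer: "\<And>i j x y. \<lbrakk>i \<in> I; j \<in> I; i \<le> j; x \<in> topspace X; y \<in> topspace X; f j x = f j y\<rbrakk>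
                  \<Longrightarrow> f i x = f i y"
    and separating: "\<And>x y. \<lbrakk>x \<in> topspace X; y \<in> topspace X; \<And>i. i \<in> I \<Longrightarrow> f i x = f i y\<rbrakk> \<Longrightarrow> x = y"
    and A: "closedin X A" and B: "closedin X B" and "A \<inter> B = {}"
  shows "\<exists>i\<in>I. f i ` A \<inter> f i ` B = {}"
proof (rule ccontr)
  assume *: "\<not> ?thesis"
  define E where "E i = {z \<in> topspace (prod_topology X X). f i (fst z) = f i (snd z)} \<inter> A \<times> B" for i
  have AB: "A \<subseteq> topspace X" "B \<subseteq> topspace X"
    using A B closedin_subset by blast+
  have "(\<Inter>i\<in>I. E i) \<noteq> {}"
  proof (rule compact_chain_nonempty_Inter)
    show "compact_space (prod_topology X X)"
      using \<open>compact_space X\<close> by (simp add: compact_space_prod_topology)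
    show "closedin (prod_topology X X) (E i)" if "i \<in> I" for i
    proof -
      have "continuous_map (prod_topology X X) (Y i) (\<lambda>z. f i (fst z))"
           "continuous_map (prod_topology X X) (Y i) (\<lambda>z. f i (snd z))"
        using continuous_map_compose[OF continuous_map_fst f[OF that]]
          continuous_map_compose[OF continuous_map_snd f[OF that]] by (simp_all add: o_def)
      moreover have "closedin (prod_topology X X) (A \<times> B)"
        using A B by (simp add: closedin_prod_Times_iff)
      ultimately show ?thesis
        unfolding E_def using Y[OF that] by (intro closedin_Int closedin_continuous_maps_eq)
    qed
    show "E i \<noteq> {}" if i: "i \<in> I" for i
    proof -
      obtain x y where "x \<in> A" "y \<in> B" "f i x = f i y" using * i by blast
      then have "(x, y) \<in> E i" using AB by (auto simp: E_def)
      then show ?thesis by blast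
    qed
    show "E j \<subseteq> E i" if "i \<in> I" "j \<in> I" "i \<le> j" for i j
    proof
      fix z assume "z \<in> E j"
      then show "z \<in> E i" using finer[OF that, of "fst z" "snd z"] by (auto simp: E_def)
    qed
  qed (rule \<open>I \<noteq> {}\<close>)
  then obtain x y where "\<And>i. i \<in> I \<Longrightarrow> (x, y) \<in> E i" by (metis INT_E ex_in_conv surj_pair)
  moreover obtain i0 where "i0 \<in> I" using \<open>I \<noteq> {}\<close> by blast
  ultimately have "x \<in> A" "y \<in> B" "\<And>i. i \<in> I \<Longrightarrow> f i x = f i y"
    by (auto simp: E_def)
  then have "x = y" using separating AB by blast
  then show False using \<open>x \<in> A\<close> \<open>y \<in> B\<close> \<open>A \<inter> B = {}\<close> by blast
qed


section \<open>Words, cylinders and null sets in the Cantor space\<close>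

definition initial_word :: "nat \<Rightarrow> (nat \<Rightarrow> bool) \<Rightarrow> bool list" where
  "initial_word n t = map t [0..<n]"

lemma length_initial_word [simp]: "length (initial_word n t) = n"
  by (simp add: initial_word_def)

lemma initial_word_Suc: "initial_word (Suc n) t = initial_word n t @ [t n]"
  by (simp add: initial_word_def)

lemma initial_word_eq_iff: "initial_word n s = initial_word n t \<longleftrightarrow> (\<forall>i<n. s i = t i)"
  by (auto simp: initial_word_def)

lemma take_initial_word: "k \<le> n \<Longrightarrow> take k (initial_word n t) = initial_word k t"
  by (simp add: initial_word_def take_map)

lemma ex_initial_word: "\<exists>t. initial_word (length w) t = w"
  by (rule exI[of _ "\<lambda>i. w ! i"]) (simp add: initial_word_def map_nth)

lemma topspace_cantor_space [simp]: "topspace cantor_space = UNIV"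
  by (simp add: cantor_space_def)

lemma openin_cylinder: "openin cantor_space {t. initial_word n t = initial_word n s}"
proof -
  define Z where "Z i = (if i < n then {s i} else UNIV)" for i
  have "{i. Z i \<noteq> UNIV} \<subseteq> {..<n}" by (auto simp: Z_def)
  then have "finite {i. Z i \<noteq> UNIV}" using finite_subset by blast
  then have "openin cantor_space (\<Pi>\<^sub>E i\<in>UNIV. Z i)"
    unfolding cantor_space_def by (intro product_topology_basis) simp_all
  moreover have "t \<in> (\<Pi>\<^sub>E i\<in>UNIV. Z i) \<longleftrightarrow> initial_word n t = initial_word n s" for t
    by (simp add: PiE_UNIV_domain Pi_iff initial_word_eq_iff Z_def)
  then have "(\<Pi>\<^sub>E i\<in>UNIV. Z i) = {t. initial_word n t = initial_word n s}" by blast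
  ultimately show ?thesis by simp
qed

lemma continuous_map_initial_word:
  "continuous_map cantor_space (discrete_topology UNIV) (initial_word n)"
proof -
  have "openin cantor_space {t. initial_word n t \<in> U}" for U
  proof (subst openin_subopen, intro ballI)
    fix s assume "s \<in> {t. initial_word n t \<in> U}"
    then show "\<exists>T. openin cantor_space T \<and> s \<in> T \<and> T \<subseteq> {t. initial_word n t \<in> U}"
      using openin_cylinder[of n s]
      by (intro exI[of _ "{t. initial_word n t = initial_word n s}"]) auto
  qed
  then show ?thesis by (auto simp: continuous_map_def)
qed

definition common_words :: "nat \<Rightarrow> (nat \<Rightarrow> bool) set \<Rightarrow> (nat \<Rightarrow> bool) set \<Rightarrow> bool list set" where
  "common_words n A B = initial_word n ` A \<inter> initial_word n ` B"

text \<open>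
  For compact \<open>A\<close> and \<open>B\<close> this says that \<open>A \<inter> B\<close> is null for the fair coin-tossing
  measure: a word of length \<open>n\<close> is common if its cylinder meets both sets, and these
  cylinders shrink to \<open>A \<inter> B\<close>. Counting words avoids the measure itself.
\<close>

definition negligible_overlap :: "(nat \<Rightarrow> bool) set \<Rightarrow> (nat \<Rightarrow> bool) set \<Rightarrow> bool" where
  "negligible_overlap A B \<longleftrightarrow> (\<lambda>n. real (card (common_words n A B)) / 2 ^ n) \<longlonglongrightarrow> 0"

lemma finite_words: "finite {w::bool list. length w = n}"
  using finite_lists_length_eq[of "UNIV :: bool set" n] by simp

lemma card_words: "card {w::bool list. length w = n} = 2 ^ n"
  using card_lists_length_eq[of "UNIV :: bool set" n] by simp

lemma finite_common_words [simp]: "finite (common_words n A B)"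
  by (rule finite_subset[OF _ finite_words[of n]]) (auto simp: common_words_def)

lemma take_common_words:
  assumes "k \<le> n" "w \<in> common_words n A B"
  shows "take k w \<in> common_words k A B"
  using assms by (auto simp: common_words_def take_initial_word) (metis imageI take_initial_word)

lemma negligible_overlap_closed_disjoint:
  assumes "closedin cantor_space A" "closedin cantor_space B" "A \<inter> B = {}"
  shows "negligible_overlap A B"
proof -
  have "\<exists>n\<in>UNIV. initial_word n ` A \<inter> initial_word n ` B = {}"
  proof (rule disjoint_closed_images_in_chain)
    show "compact_space cantor_space"
      by (simp add: cantor_space_def compact_space_product_topology compact_space_discrete_topology)
    show "x = y" if "\<And>n. n \<in> UNIV \<Longrightarrow> initial_word n x = initial_word n y" for x y
    proof
      fix i
      have "initial_word (Suc i) x = initial_word (Suc i) y" using that by simp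
      then show "x i = y i" by (simp add: initial_word_eq_iff)
    qed
    show "continuous_map cantor_space (discrete_topology UNIV) (initial_word n)" for n
      by (rule continuous_map_initial_word)
    show "initial_word i x = initial_word i y" if "i \<le> j" "initial_word j x = initial_word j y" for i j x y
      using that by (auto simp: initial_word_eq_iff)
  qed (use assms in auto)
  then obtain k where k: "common_words k A B = {}" by (auto simp: common_words_def)
  have "eventually (\<lambda>n. real (card (common_words n A B)) / 2 ^ n = 0) sequentially"
    using eventually_ge_at_top[of k]
  proof eventually_elim
    case (elim n)
    then have "common_words n A B = {}" using take_common_words k by blast
    then show ?case by simp
  qed
  then show ?thesis
    unfolding negligible_overlap_def by (rule tendsto_eventually)
qed

lemma card_words_with_prefix_le:
  assumes "k \<le> n" "length u = k"
  shows "card {w::bool list. length w = n \<and> take k w = u} \<le> 2 ^ (n - k)"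
proof -
  have "{w. length w = n \<and> take k w = u} \<subseteq> (\<lambda>v. u @ v) ` {v. length v = n - k}"
  proof
    fix w :: "bool list" assume "w \<in> {w. length w = n \<and> take k w = u}"
    then have "w = u @ drop k w" "length (drop k w) = n - k"
      using append_take_drop_id[of k w] by auto
    then show "w \<in> (\<lambda>v. u @ v) ` {v. length v = n - k}" by blast
  qed
  then have "card {w. length w = n \<and> take k w = u} \<le> card ((\<lambda>v. u @ v) ` {v::bool list. length v = n - k})"
    by (intro card_mono) (auto simp: finite_words)
  also have "\<dots> \<le> 2 ^ (n - k)"
    using card_image_le[OF finite_words, of "\<lambda>v. u @ v" "n - k"] by (simp add: card_words)
  finally show ?thesis .
qed

text \<open>
  A point has measure zero: the cylinder of depth \<open>k\<close> around \<open>s\<close> contains only the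
  fraction \<open>2\<^sup>-\<^sup>k\<close> of the words, so what happens inside it can be neglected.
\<close>

lemma negligible_overlap_off_point:
  assumes off: "\<And>k. negligible_overlap (A - {t. initial_word k t = initial_word k s})
                     (B - {t. initial_word k t = initial_word k s})"
  shows "negligible_overlap A B"
  unfolding negligible_overlap_def
proof (rule LIMSEQ_I)
  fix e :: real assume "e > 0"
  obtain k where k: "(1/2::real) ^ k < e / 2"
    using real_arch_pow_inv[of "e/2" "1/2"] \<open>e > 0\<close> by auto
  define C where "C = {t. initial_word k t = initial_word k s}"
  obtain N where N: "\<And>n. n \<ge> N \<Longrightarrow> norm (real (card (common_words n (A - C) (B - C))) / 2 ^ n - 0) < e / 2"
    using LIMSEQ_D[OF off[of k, unfolded negligible_overlap_def], of "e/2"] \<open>e > 0\<close>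
    unfolding C_def by auto
  show "\<exists>N. \<forall>n\<ge>N. norm (real (card (common_words n A B)) / 2 ^ n - 0) < e"
  proof (intro exI[of _ "max N k"] allI impI)
    fix n assume "n \<ge> max N k"
    then have n: "n \<ge> N" "k \<le> n" by auto
    define D where "D = {w::bool list. length w = n \<and> take k w = initial_word k s}"
    have "common_words n A B \<subseteq> common_words n (A - C) (B - C) \<union> D"
    proof
      fix w assume "w \<in> common_words n A B"
      then obtain a b where ab: "a \<in> A" "b \<in> B" "w = initial_word n a" "w = initial_word n b"
        by (auto simp: common_words_def)
      then have take: "take k w = initial_word k a" "take k w = initial_word k b"
        using n take_initial_word by metis+
      show "w \<in> common_words n (A - C) (B - C) \<union> D"
      proof (cases "take k w = initial_word k s")
        case True then show ?thesis using ab by (auto simp: D_def)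
      next
        case False
        then have "a \<in> A - C" "b \<in> B - C" using take ab by (auto simp: C_def)
        then have "w \<in> initial_word n ` (A - C)" "w \<in> initial_word n ` (B - C)"
          using ab by blast+
        then show ?thesis by (simp add: common_words_def)
      qed
    qed
    moreover have "finite D"
      by (rule finite_subset[OF _ finite_words[of n]]) (auto simp: D_def)
    ultimately have "card (common_words n A B) \<le> card (common_words n (A - C) (B - C) \<union> D)"
      by (intro card_mono) auto
    also have "\<dots> \<le> card (common_words n (A - C) (B - C)) + card D" by (rule card_Un_le)
    also have "card D \<le> 2 ^ (n - k)"
      unfolding D_def using n by (intro card_words_with_prefix_le) auto
    finally have "card (common_words n A B) \<le> card (common_words n (A - C) (B - C)) + 2 ^ (n - k)" by simp
    then have "real (card (common_words n A B)) \<le> real (card (common_words n (A - C) (B - C))) + 2 ^ (n - k)"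
      by (metis of_nat_add of_nat_le_iff of_nat_numeral of_nat_power)
    then have "real (card (common_words n A B)) / 2 ^ n
        \<le> real (card (common_words n (A - C) (B - C))) / 2 ^ n + 2 ^ (n - k) / 2 ^ n"
      unfolding add_divide_distrib[symmetric] by (intro divide_right_mono) simp_all
    also have "(2::real) ^ (n - k) / 2 ^ n = (1/2) ^ k"
      using n by (simp add: power_diff power_one_over divide_simps)
    also have "real (card (common_words n (A - C) (B - C))) / 2 ^ n < e / 2"
      using N[OF n(1)] by simp
    finally show "norm (real (card (common_words n A B)) / 2 ^ n - 0) < e" using k by simp
  qed
qed


section \<open>Finitely supported signed measures\<close>

definition atomic_measure :: "'a set \<Rightarrow> ('a \<Rightarrow> real) \<Rightarrow> 'a set \<Rightarrow> real" where
  "atomic_measure S c A = (\<Sum>x\<in>S \<inter> A. c x)"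

lemma space_borel_algebra [simp]: "space (borel_algebra X) = topspace X"
  by (simp add: borel_algebra_def space_measure_of_conv)

lemma sets_borel_algebra: "borel_sets X = sigma_sets (topspace X) {U. openin X U}"
  unfolding borel_algebra_def by (rule sets_measure_of) (auto dest: openin_subset)

lemma openin_borel: "openin X U \<Longrightarrow> U \<in> borel_sets X"
  by (simp add: sets_borel_algebra sigma_sets.Basic)

lemma closedin_borel: "closedin X C \<Longrightarrow> C \<in> borel_sets X"
  using sets.compl_sets[OF openin_borel, of X "topspace X - C"] closedin_subset[of X C]
  by (simp add: closedin_def double_diff)

lemma finite_borel:
  assumes "Hausdorff_space X" "finite F" "F \<subseteq> topspace X"
  shows "F \<in> borel_sets X"
  using assms by (intro closedin_borel closedin_Hausdorff_finite)

lemma atomic_measure_uminus: "atomic_measure S (\<lambda>x. - c x) A = - atomic_measure S c A"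
  by (simp add: atomic_measure_def sum_negf)

lemma signed_borel_measure_atomic:
  assumes "finite S"
  shows "signed_borel_measure X (atomic_measure S c)"
  unfolding signed_borel_measure_def
proof (intro conjI allI impI)
  show "atomic_measure S c {} = 0" by (simp add: atomic_measure_def)
  fix A :: "nat \<Rightarrow> 'a set" assume A: "range A \<subseteq> borel_sets X \<and> disjoint_family A"
  have eq: "atomic_measure S c B = (\<Sum>x\<in>S. if x \<in> B then c x else 0)" for B
    using assms by (simp add: atomic_measure_def sum.inter_restrict)
  have "(\<lambda>n. if x \<in> A n then c x else 0) sums (if x \<in> (\<Union>n. A n) then c x else 0)" for x
  proof (cases "x \<in> (\<Union>n. A n)")
    case True
    then obtain k where "x \<in> A k" by blast
    then have "x \<in> A n \<longleftrightarrow> n = k" for n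
      using A by (auto simp: disjoint_family_on_def)
    then show ?thesis using True sums_single[of k "\<lambda>_. c x"] by simp
  qed auto
  then show "(\<lambda>n. atomic_measure S c (A n)) sums atomic_measure S c (\<Union>n. A n)"
    unfolding eq by (intro sums_sum)
qed

lemma variation_atomic_eq_0:
  assumes "A \<inter> S = {}"
  shows "variation X (atomic_measure S c) A = 0"
proof -
  have "(\<Sum>B\<in>P. ennreal \<bar>atomic_measure S c B\<bar>) = 0" if "\<Union>P = A" for P
  proof (rule sum.neutral, intro ballI)
    fix B assume "B \<in> P"
    then have "S \<inter> B = {}" using that assms by blast
    then show "ennreal \<bar>atomic_measure S c B\<bar> = 0" by (simp add: atomic_measure_def)
  qed
  then have "variation X (atomic_measure S c) A \<le> 0"
    unfolding variation_def by (intro SUP_least) auto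
  then show ?thesis by simp
qed

text \<open>
  Inner regularity is trivial: the finitely many atoms inside a Borel set form a compact set
  that carries the whole variation.
\<close>

lemma signed_radon_measure_atomic:
  assumes "finite S"
  shows "signed_radon_measure X (atomic_measure S c)"
  unfolding signed_radon_measure_def
proof (intro conjI ballI allI impI)
  show "signed_borel_measure X (atomic_measure S c)"
    using assms by (rule signed_borel_measure_atomic)
  fix A and e :: ennreal assume A: "A \<in> borel_sets X" and "e > 0"
  have "A \<subseteq> topspace X" using sets.sets_into_space[OF A] by simp
  then have "compactin X (A \<inter> S)" using assms by (intro finite_imp_compactin) auto
  moreover have "variation X (atomic_measure S c) (A - A \<inter> S) = 0"
    by (rule variation_atomic_eq_0) auto
  ultimately show "\<exists>C. compactin X C \<and> C \<subseteq> A \<and> variation X (atomic_measure S c) (A - C) < e"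
    using \<open>e > 0\<close> by (intro exI[of _ "A \<inter> S"]) auto
qed

lemma finitely_supported_atomic:
  assumes "Hausdorff_space X" "finite S" "S \<subseteq> topspace X"
  shows "finitely_supported X (atomic_measure S c)"
proof -
  have "openin X (topspace X - S)"
    using closedin_Hausdorff_finite[OF assms(1,3,2)] by blast
  moreover have "variation X (atomic_measure S c) (topspace X - S) = 0"
    by (rule variation_atomic_eq_0) auto
  ultimately have "measure_support X (atomic_measure S c) \<subseteq> S"
    unfolding measure_support_def by force
  then show ?thesis
    using \<open>finite S\<close> finite_subset unfolding finitely_supported_def by blast
qed

text \<open>
  The supremum of the definition is attained by the partition into the atoms and the rest.
\<close>

lemma total_variation_norm_atomic:
  assumes "Hausdorff_space X" "finite S" "S \<subseteq> topspace X"
  shows "total_variation_norm X (atomic_measure S c) = ennreal (\<Sum>x\<in>S. \<bar>c x\<bar>)"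
proof (rule antisym)
  let ?m = "atomic_measure S c"
  have "(\<Sum>B\<in>P. ennreal \<bar>?m B\<bar>) \<le> ennreal (\<Sum>x\<in>S. \<bar>c x\<bar>)"
    if "finite P" "disjoint P" for P
  proof -
    have "(\<Sum>B\<in>P. \<bar>?m B\<bar>) \<le> (\<Sum>B\<in>P. \<Sum>x\<in>S \<inter> B. \<bar>c x\<bar>)"
      unfolding atomic_measure_def by (intro sum_mono sum_abs)
    also have "\<dots> = (\<Sum>x\<in>(\<Union>B\<in>P. S \<inter> B). \<bar>c x\<bar>)"
      using that assms by (intro sum.UNION_disjoint[symmetric]) (auto simp: disjoint_def)
    also have "\<dots> \<le> (\<Sum>x\<in>S. \<bar>c x\<bar>)"
      using assms by (intro sum_mono2) auto
    finally show ?thesis by (simp add: ennreal_leI sum_ennreal)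
  qed
  then show "total_variation_norm X ?m \<le> ennreal (\<Sum>x\<in>S. \<bar>c x\<bar>)"
    unfolding total_variation_norm_def variation_def by (intro SUP_least) auto
  define P where "P = insert (topspace X - S) ((\<lambda>x. {x}) ` S)"
  have "P \<subseteq> borel_sets X"
    using assms finite_borel[OF assms] by (auto simp: P_def intro!: finite_borel sets.Diff sets.top[of "borel_algebra X", simplified])
  moreover have "disjoint P" "\<Union>P = topspace X" "finite P"
    using assms by (auto simp: P_def disjoint_def)
  ultimately have "(\<Sum>B\<in>P. ennreal \<bar>?m B\<bar>) \<le> total_variation_norm X ?m"
    unfolding total_variation_norm_def variation_def by (intro SUP_upper) auto
  moreover have "(\<Sum>B\<in>(\<lambda>x. {x}) ` S. ennreal \<bar>?m B\<bar>) \<le> (\<Sum>B\<in>P. ennreal \<bar>?m B\<bar>)"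
    using assms by (intro sum_mono2) (auto simp: P_def)
  moreover have "(\<Sum>B\<in>(\<lambda>x. {x}) ` S. ennreal \<bar>?m B\<bar>) = ennreal (\<Sum>x\<in>S. \<bar>c x\<bar>)"
    by (subst sum.reindex) (auto simp: atomic_measure_def simp flip: sum_ennreal intro!: sum.cong)
  ultimately show "ennreal (\<Sum>x\<in>S. \<bar>c x\<bar>) \<le> total_variation_norm X ?m"
    by (metis order.trans)
qed

text \<open>
  The supremum that defines the positive part at \<open>A\<close> is attained by the finite set of atoms
  in \<open>A\<close> of positive mass, hence the positive part is the sum of point masses with the
  truncated weights \<open>max (c x) 0\<close>, realised here as the image of a measure on \<open>S\<close>.
\<close>

lemma integral_positive_part_atomic:
  assumes "Hausdorff_space X" "finite S" "S \<subseteq> topspace X" "continuous_map X euclideanreal f"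
  shows "integral\<^sup>L (positive_part X (atomic_measure S c)) f = (\<Sum>x\<in>S. max (c x) 0 * f x)"
proof -
  define N where "N = point_measure S (\<lambda>x. ennreal (max (c x) 0))"
  define M where "M = distr N (borel_algebra X) (\<lambda>x. x)"
  have meas: "(\<lambda>x. x) \<in> measurable N (borel_algebra X)"
    using assms by (auto simp: N_def measurable_def space_point_measure sets_point_measure)
  have f: "f \<in> borel_measurable (borel_algebra X)"
  proof (rule borel_measurableI)
    fix U :: "real set" assume "open U"
    then have "openin X {x \<in> topspace X. f x \<in> U}"
      using assms(4) by (auto simp: continuous_map_def)
    then show "f -` U \<inter> space (borel_algebra X) \<in> borel_sets X"
      using openin_borel by (simp add: vimage_def Int_def conj_commute)
  qed
  have "emeasure M A = (SUP B \<in> {B \<in> borel_sets X. B \<subseteq> A}. ennreal (atomic_measure S c B))"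
    if A: "A \<in> borel_sets X" for A
  proof -
    have "emeasure M A = emeasure N (S \<inter> A)"
      unfolding M_def emeasure_distr[OF meas A] by (simp add: N_def space_point_measure Int_commute)
    also have "\<dots> = ennreal (\<Sum>x\<in>S \<inter> A. max (c x) 0)"
      using assms by (simp add: N_def emeasure_point_measure_finite sum_ennreal)
    also have "\<dots> = (SUP B \<in> {B \<in> borel_sets X. B \<subseteq> A}. ennreal (atomic_measure S c B))"
    proof (rule antisym)
      let ?B = "{x \<in> S \<inter> A. c x > 0}"
      have "?B \<in> borel_sets X" using assms by (intro finite_borel) auto
      moreover have "(\<Sum>x\<in>S \<inter> A. max (c x) 0) = atomic_measure S c ?B"
        unfolding atomic_measure_def using assms
        by (intro sum.mono_neutral_cong_right) (auto simp: max_def)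
      ultimately show "ennreal (\<Sum>x\<in>S \<inter> A. max (c x) 0)
          \<le> (SUP B \<in> {B \<in> borel_sets X. B \<subseteq> A}. ennreal (atomic_measure S c B))"
        by (intro SUP_upper2[of ?B]) auto
      show "(SUP B \<in> {B \<in> borel_sets X. B \<subseteq> A}. ennreal (atomic_measure S c B))
          \<le> ennreal (\<Sum>x\<in>S \<inter> A. max (c x) 0)"
      proof (intro SUP_least ennreal_leI)
        fix B assume B: "B \<in> {B \<in> borel_sets X. B \<subseteq> A}"
        have "atomic_measure S c B \<le> (\<Sum>x\<in>S \<inter> B. max (c x) 0)"
          unfolding atomic_measure_def by (intro sum_mono) auto
        also have "\<dots> \<le> (\<Sum>x\<in>S \<inter> A. max (c x) 0)"
          using B assms by (intro sum_mono2) auto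
        finally show "atomic_measure S c B \<le> (\<Sum>x\<in>S \<inter> A. max (c x) 0)" .
      qed
    qed
    finally show ?thesis .
  qed
  moreover have "borel_sets X \<subseteq> Pow (topspace X)"
    using sets.space_closed[of "borel_algebra X"] by simp
  moreover have "sigma_sets (topspace X) (borel_sets X) = borel_sets X"
    using sets.sigma_sets_eq[of "borel_algebra X"] by simp
  ultimately have "positive_part X (atomic_measure S c) = measure_of (topspace X) (borel_sets X) (emeasure M)"
    unfolding positive_part_def by (intro measure_of_eq) auto
  also have "\<dots> = M"
    using measure_of_of_measure[of M] by (simp add: M_def)
  finally have "integral\<^sup>L (positive_part X (atomic_measure S c)) f = integral\<^sup>L N f"
    unfolding M_def using integral_distr[OF meas f] by simp
  also have "\<dots> = (\<Sum>x\<in>S. max (c x) 0 * f x)"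
    unfolding N_def using assms by (subst lebesgue_integral_point_measure_finite) auto
  finally show ?thesis .
qed

lemma signed_integral_atomic:
  assumes "Hausdorff_space X" "finite S" "S \<subseteq> topspace X" "continuous_map X euclideanreal f"
  shows "signed_integral X (atomic_measure S c) f = (\<Sum>x\<in>S. c x * f x)"
proof -
  have "signed_integral X (atomic_measure S c) f
      = (\<Sum>x\<in>S. max (c x) 0 * f x) - (\<Sum>x\<in>S. max (- c x) 0 * f x)"
    unfolding signed_integral_def atomic_measure_uminus[symmetric]
    by (simp only: integral_positive_part_atomic[OF assms])
  also have "\<dots> = (\<Sum>x\<in>S. c x * f x)"
    unfolding sum_subtractf[symmetric] by (intro sum.cong) (auto simp: max_def)
  finally show ?thesis .
qed


section \<open>Small oscillation over most cylinders yields the property\<close>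

lemma continuous_map_real_bounded:
  assumes "compact_space X" "continuous_map X euclideanreal f"
  shows "\<exists>M. \<forall>x\<in>topspace X. \<bar>f x\<bar> \<le> M"
proof -
  have "compact (f ` topspace X)"
    using image_compactin[of X "topspace X" euclideanreal f] assms
    by (simp add: compact_space_def)
  then show ?thesis
    using compact_imp_bounded bounded_iff by (metis imageI real_norm_def)
qed

text \<open>
  If \<open>f\<close> climbs by \<open>e\<close> from \<open>x\<close> to \<open>y\<close>, then it crosses a whole interval of some fixed grid of
  mesh \<open>e / 2\<close>: \<open>x\<close> lies in the closed set where \<open>f\<close> is below the interval and \<open>y\<close> in the one
  where \<open>f\<close> is above it. As \<open>f\<close> is bounded, finitely many such pairs of disjoint closed
  sets account for all the words.
\<close>

lemma negligible_overlap_oscillation: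
  assumes X: "compact_space X"
    and f: "continuous_map X euclideanreal f" and "e > 0"
    and negligible: "\<And>A B. \<lbrakk>closedin X A; closedin X B; A \<inter> B = {}\<rbrakk> \<Longrightarrow> negligible_overlap (q ` A) (q ` B)"
  defines "W \<equiv> \<lambda>n. {w. \<exists>x\<in>topspace X. \<exists>y\<in>topspace X.
      initial_word n (q x) = w \<and> initial_word n (q y) = w \<and> f x + e \<le> f y}"
  shows "(\<lambda>n. real (card (W n)) / 2 ^ n) \<longlonglongrightarrow> 0"
proof -
  obtain M where M: "\<And>x. x \<in> topspace X \<Longrightarrow> \<bar>f x\<bar> \<le> M"
    using continuous_map_real_bounded[OF X f] by blast
  define I where "I = {\<lceil>- 2 * M / e\<rceil>..\<lceil>2 * M / e\<rceil>}"
  define A where "A i = {x \<in> topspace X. f x \<in> {..real_of_int i * (e/2)}}" for i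
  define B where "B i = {x \<in> topspace X. f x \<in> {real_of_int (i + 1) * (e/2)..}}" for i
  have "closedin X (A i)" "closedin X (B i)" for i
    unfolding A_def B_def by (intro closedin_continuous_map_preimage[OF f], simp)+
  moreover have "real_of_int i * (e/2) < real_of_int (i + 1) * (e/2)" for i
    using \<open>e > 0\<close> by (intro mult_strict_right_mono) auto
  then have "A i \<inter> B i = {}" for i
    unfolding A_def B_def by (smt (verit) atLeast_iff atMost_iff disjoint_iff mem_Collect_eq)
  ultimately have "(\<lambda>n. real (card (common_words n (q ` A i) (q ` B i))) / 2 ^ n) \<longlonglongrightarrow> 0" for i
    unfolding negligible_overlap_def[symmetric] by (intro negligible)
  then have lim: "(\<lambda>n. \<Sum>i\<in>I. real (card (common_words n (q ` A i) (q ` B i))) / 2 ^ n) \<longlonglongrightarrow> (\<Sum>i\<in>I. 0)"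
    by (intro tendsto_sum)
  have W: "W n \<subseteq> (\<Union>i\<in>I. common_words n (q ` A i) (q ` B i))" for n
  proof
    fix w assume "w \<in> W n"
    then obtain x y where xy: "x \<in> topspace X" "y \<in> topspace X" "f x + e \<le> f y"
        "w = initial_word n (q x)" "w = initial_word n (q y)"
      by (auto simp: W_def)
    \<comment> \<open>the number of the first grid point \<open>i * (e / 2)\<close> that is at least \<open>f x\<close>\<close>
    define i where "i = \<lceil>2 * f x / e\<rceil>"
    have i: "2 * f x / e \<le> i" "i < 2 * f x / e + 1"
      unfolding i_def by linarith+
    then have "x \<in> A i" "y \<in> B i"
      using xy \<open>e > 0\<close> by (simp_all add: A_def B_def field_simps)
    then have "w \<in> initial_word n ` q ` A i" "w \<in> initial_word n ` q ` B i"
      using xy by blast+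
    then have "w \<in> common_words n (q ` A i) (q ` B i)"
      by (simp add: common_words_def)
    moreover have "- 2 * M / e \<le> 2 * f x / e" "2 * f x / e \<le> 2 * M / e"
      using M[OF xy(1)] \<open>e > 0\<close> by (intro divide_right_mono, auto)+
    then have "i \<in> I"
      unfolding I_def i_def by (simp add: ceiling_mono)
    ultimately show "w \<in> (\<Union>i\<in>I. common_words n (q ` A i) (q ` B i))" by blast
  qed
  have "real (card (W n)) / 2 ^ n \<le> (\<Sum>i\<in>I. real (card (common_words n (q ` A i) (q ` B i))) / 2 ^ n)" for n
  proof -
    have "card (W n) \<le> card (\<Union>i\<in>I. common_words n (q ` A i) (q ` B i))"
      using W by (intro card_mono) (auto simp: I_def)
    also have "\<dots> \<le> (\<Sum>i\<in>I. card (common_words n (q ` A i) (q ` B i)))"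
      by (intro card_UN_le) (simp add: I_def)
    finally have "real (card (W n)) \<le> (\<Sum>i\<in>I. real (card (common_words n (q ` A i) (q ` B i))))"
      by (metis of_nat_le_iff of_nat_sum)
    then show ?thesis
      unfolding sum_divide_distrib[symmetric] by (intro divide_right_mono) simp_all
  qed
  then show ?thesis
    using lim by (intro tendsto_sandwich[OF _ _ tendsto_const lim[simplified]]) auto
qed

text \<open>
  Each word \<open>w\<close> has a point \<open>z w\<close> of \<open>X\<close> over its cylinder. The \<open>n\<close>-th measure gives the points of
  the words of length \<open>n + 1\<close> the mass \<open>1 / 2\<^sup>n\<^sup>+\<^sup>1\<close>, with a sign given by the last letter, so
  that the two extensions of a word of length \<open>n\<close> nearly cancel on any function that
  oscillates little over the cylinder of that word. All but a vanishing fraction of the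
  cylinders are of this kind.
\<close>

lemma fsJNP_if_negligible_overlaps:
  assumes X: "compact_space X" "Hausdorff_space X"
    and onto: "q ` topspace X = UNIV"
    and negligible: "\<And>A B. \<lbrakk>closedin X A; closedin X B; A \<inter> B = {}\<rbrakk> \<Longrightarrow> negligible_overlap (q ` A) (q ` B)"
  shows "fsJNP X"
proof -
  have "\<exists>x\<in>topspace X. initial_word (length w) (q x) = w" for w
    using ex_initial_word[of w] onto by (metis UNIV_I imageE)
  then obtain z where z: "\<And>w. z w \<in> topspace X" "\<And>w. initial_word (length w) (q (z w)) = w"
    by metis
  define V where "V n = {w::bool list. length w = n}" for n
  define S where "S n = z ` V (Suc n)" for n
  define c where "c n x = (if q x n then 1 else - 1 :: real) / 2 ^ Suc n" for n x
  have S: "finite (S n)" "S n \<subseteq> topspace X" for n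
    using z finite_words by (auto simp: S_def V_def)
  have "inj_on z (V n)" for n
    by (rule inj_on_inverseI[of _ "\<lambda>x. initial_word n (q x)"]) (use z in \<open>auto simp: V_def\<close>)
  then have sum_S: "(\<Sum>x\<in>S n. g x) = (\<Sum>w\<in>V (Suc n). g (z w))" for n and g :: "_ \<Rightarrow> real"
    unfolding S_def by (subst sum.reindex) auto
  have last_letter: "q (z (v @ [b])) n \<longleftrightarrow> b" if "v \<in> V n" for v b n
    using z(2)[of "v @ [b]"] that by (simp add: V_def initial_word_Suc)
  have V_Suc: "V (Suc n) = (\<lambda>v. v @ [True]) ` V n \<union> (\<lambda>v. v @ [False]) ` V n" for n
  proof -
    have "w \<in> (\<lambda>v. v @ [True]) ` V n \<union> (\<lambda>v. v @ [False]) ` V n" if "length w = Suc n" for w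
    proof -
      have "w = butlast w @ [last w]" "butlast w \<in> V n"
        using that by (auto simp: V_def intro!: append_butlast_last_id[symmetric])
      then show ?thesis by (cases "last w") auto
    qed
    then show ?thesis by (auto simp: V_def)
  qed
  have sum_V_Suc: "(\<Sum>w\<in>V (Suc n). g w) = (\<Sum>v\<in>V n. g (v @ [True]) + g (v @ [False]))"
    for n and g :: "_ \<Rightarrow> real"
    unfolding V_Suc using finite_words
    by (subst sum.union_disjoint) (auto simp: V_def sum.reindex inj_on_def sum.distrib)
  have norm: "total_variation_norm X (atomic_measure (S n) (c n)) = 1" for n
  proof -
    have "(\<Sum>x\<in>S n. \<bar>c n x\<bar>) = (\<Sum>w\<in>V (Suc n). 1 / 2 ^ Suc n)"
      unfolding sum_S by (intro sum.cong) (auto simp: c_def)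
    also have "\<dots> = 1" by (simp add: V_def card_words)
    finally show ?thesis using total_variation_norm_atomic[OF X(2) S] by simp
  qed
  have "(\<lambda>n. signed_integral X (atomic_measure (S n) (c n)) f) \<longlonglongrightarrow> 0"
    if f: "continuous_map X euclideanreal f" for f
  proof (rule LIMSEQ_I)
    fix e :: real assume "e > 0"
    obtain M where M: "\<And>x. x \<in> topspace X \<Longrightarrow> \<bar>f x\<bar> \<le> M"
      using continuous_map_real_bounded[OF X(1) f] by blast
    define W where "W n = {w. \<exists>x\<in>topspace X. \<exists>y\<in>topspace X.
      initial_word n (q x) = w \<and> initial_word n (q y) = w \<and> f x + e \<le> f y}" for n
    have "(\<lambda>n. M * (real (card (W n)) / 2 ^ n)) \<longlonglongrightarrow> M * 0"
      unfolding W_def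
      by (intro tendsto_mult tendsto_const negligible_overlap_oscillation[OF X(1) f \<open>e > 0\<close> negligible])
    then obtain N where N: "\<And>n. n \<ge> N \<Longrightarrow> norm (M * (real (card (W n)) / 2 ^ n) - 0) < e / 2"
      using LIMSEQ_D[of _ "M * 0" "e/2"] \<open>e > 0\<close> by fastforce
    show "\<exists>N. \<forall>n\<ge>N. norm (signed_integral X (atomic_measure (S n) (c n)) f - 0) < e"
    proof (intro exI[of _ N] allI impI)
      fix n assume "n \<ge> N"
      have "W n \<subseteq> V n" by (auto simp: W_def V_def)
      have pair: "\<bar>f (z (v @ [True])) - f (z (v @ [False]))\<bar> \<le> (if v \<in> W n then 2 * M else 0) + e"
        if v: "v \<in> V n" for v
      proof (cases "v \<in> W n")
        case True
        then show ?thesis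
          using M[OF z(1)[of "v @ [True]"]] M[OF z(1)[of "v @ [False]"]] \<open>e > 0\<close> by simp
      next
        case False
        have "initial_word n (q (z (v @ [b]))) = v" for b
          using z(2)[of "v @ [b]"] v by (simp add: V_def initial_word_Suc)
        then have "\<not> f (z (v @ [b])) + e \<le> f (z (v @ [b']))" for b b'
          using False z(1) unfolding W_def by blast
        from this[of True False] this[of False True] show ?thesis using False by simp
      qed
      have "signed_integral X (atomic_measure (S n) (c n)) f = (\<Sum>x\<in>S n. c n x * f x)"
        by (rule signed_integral_atomic[OF X(2) S f])
      also have "\<dots> = (\<Sum>v\<in>V n. (f (z (v @ [True])) - f (z (v @ [False]))) / 2 ^ Suc n)"
        unfolding sum_S sum_V_Suc
        by (intro sum.cong refl) (simp add: c_def last_letter diff_divide_distrib)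
      finally have "\<bar>signed_integral X (atomic_measure (S n) (c n)) f\<bar>
          \<le> (\<Sum>v\<in>V n. \<bar>(f (z (v @ [True])) - f (z (v @ [False]))) / 2 ^ Suc n\<bar>)"
        by (simp only: sum_abs)
      also have "\<dots> \<le> (\<Sum>v\<in>V n. ((if v \<in> W n then 2 * M else 0) + e) / 2 ^ Suc n)"
        using pair by (intro sum_mono) (simp add: divide_right_mono)
      also have "\<dots> = (\<Sum>v\<in>V n. (if v \<in> W n then 2 * M else 0) + e) / 2 ^ Suc n"
        by (simp add: sum_divide_distrib)
      also have "(\<Sum>v\<in>V n. (if v \<in> W n then 2 * M else 0) + e) = 2 * M * card (W n) + e * 2 ^ n"
        using finite_words[of n] \<open>W n \<subseteq> V n\<close>
        by (simp add: sum.distrib V_def card_words sum.inter_restrict[symmetric] Int_absorb1)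
      also have "(2 * M * card (W n) + e * 2 ^ n) / 2 ^ Suc n = M * (card (W n) / 2 ^ n) + e / 2"
        by (simp add: field_simps)
      also have "\<dots> < e" using N[OF \<open>n \<ge> N\<close>] unfolding real_norm_def diff_0_right by linarith
      finally show "norm (signed_integral X (atomic_measure (S n) (c n)) f - 0) < e" by simp
    qed
  qed
  then show ?thesis
    unfolding fsJNP_def
    using norm signed_radon_measure_atomic[OF S(1)] finitely_supported_atomic[OF X(2) S]
    by (intro exI[of _ "\<lambda>n. atomic_measure (S n) (c n)"]) blast
qed


section \<open>Systems of simple extensions over the Cantor space\<close>

lemma ord_zero_le: "ord_zero \<le> (a::'i::wellorder)"
  unfolding ord_zero_def by (rule Least_le) simp

lemma ordinal_cases:
  obtains (zero) "b = ord_zero" | (succ) a where "a < b" "b = ord_succ a" | (limit) "ord_limit b"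
proof (cases "b = ord_zero \<or> ord_limit b")
  case False
  then have "\<exists>a. a < b" using ord_zero_le[of b] by (metis order_neq_le_trans)
  then obtain a where a: "a < b" "\<And>c. a < c \<Longrightarrow> \<not> c < b"
    using False unfolding ord_limit_def by blast
  have "ord_succ a = b"
    unfolding ord_succ_def by (rule Least_equality) (use a not_le in auto)
  then show thesis using a succ by blast
qed (use zero limit in auto)

locale simple_extension_system =
  fixes \<delta> :: "'i::wellorder" and K :: "'i \<Rightarrow> 'a topology" and \<pi> :: "'i \<Rightarrow> 'i \<Rightarrow> 'a \<Rightarrow> 'a"
    and h :: "'a \<Rightarrow> nat \<Rightarrow> bool"
  assumes system: "system_of_simple_extensions \<delta> K \<pi>"
    and h: "homeomorphic_map (K ord_zero) cantor_space h"
begin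

definition to_cantor :: "'i \<Rightarrow> 'a \<Rightarrow> nat \<Rightarrow> bool" where
  "to_cantor b x = h (\<pi> ord_zero b x)"

lemma compact: "b \<le> \<delta> \<Longrightarrow> compact_space (K b)" and Hausdorff: "b \<le> \<delta> \<Longrightarrow> Hausdorff_space (K b)"
  using system by (auto simp: system_of_simple_extensions_def)

lemma bonding_continuous: "\<lbrakk>a \<le> b; b \<le> \<delta>\<rbrakk> \<Longrightarrow> continuous_map (K b) (K a) (\<pi> a b)"
  using system by (auto simp: system_of_simple_extensions_def inverse_system_def)

lemma bonding_in_topspace: "\<lbrakk>a \<le> b; b \<le> \<delta>; x \<in> topspace (K b)\<rbrakk> \<Longrightarrow> \<pi> a b x \<in> topspace (K a)"
  using continuous_map_funspace[OF bonding_continuous] by blast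

lemma bonding_id: "\<lbrakk>a \<le> \<delta>; x \<in> topspace (K a)\<rbrakk> \<Longrightarrow> \<pi> a a x = x"
  using system by (auto simp: system_of_simple_extensions_def inverse_system_def)

lemma bonding_comp:
  "\<lbrakk>a \<le> b; b \<le> c; c \<le> \<delta>; x \<in> topspace (K c)\<rbrakk> \<Longrightarrow> \<pi> a b (\<pi> b c x) = \<pi> a c x"
  using system by (auto simp: system_of_simple_extensions_def inverse_system_def)

lemma bonding_closed:
  assumes "a \<le> b" "b \<le> \<delta>" "closedin (K b) A"
  shows "closedin (K a) (\<pi> a b ` A)"
proof -
  have "compactin (K a) (\<pi> a b ` A)"
    using assms by (intro image_compactin[OF closedin_compact_space bonding_continuous] compact)
  then show ?thesis using assms by (intro compactin_imp_closedin Hausdorff) auto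
qed

lemma limit_homeomorphic:
  "\<lbrakk>b \<le> \<delta>; ord_limit b\<rbrakk> \<Longrightarrow>
    homeomorphic_map (K b) (inverse_limit {..<b} K \<pi>) (\<lambda>x. \<lambda>a\<in>{..<b}. \<pi> a b x)"
  using system by (auto simp: system_of_simple_extensions_def continuous_inverse_system_def)

lemma limit_separating:
  assumes "b \<le> \<delta>" "ord_limit b" "x \<in> topspace (K b)" "y \<in> topspace (K b)"
    and "\<And>a. a < b \<Longrightarrow> \<pi> a b x = \<pi> a b y"
  shows "x = y"
proof -
  have "(\<lambda>a\<in>{..<b}. \<pi> a b x) = (\<lambda>a\<in>{..<b}. \<pi> a b y)"
    using assms(5) by (auto simp: restrict_def)
  then show ?thesis
    using inj_onD[OF homeomorphic_imp_injective_map[OF limit_homeomorphic[OF assms(1,2)]]] assms(3,4)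
    by blast
qed

lemma limit_thread:
  assumes "b \<le> \<delta>" "ord_limit b"
    and "\<And>a. a < b \<Longrightarrow> t a \<in> topspace (K a)"
    and "\<And>a a'. \<lbrakk>a \<le> a'; a' < b\<rbrakk> \<Longrightarrow> \<pi> a a' (t a') = t a"
  shows "\<exists>y\<in>topspace (K b). \<forall>a<b. \<pi> a b y = t a"
proof -
  have "restrict t {..<b} \<in> topspace (inverse_limit {..<b} K \<pi>)"
    using assms(3,4) by (auto simp: inverse_limit_def)
  then obtain y where y: "y \<in> topspace (K b)" "restrict t {..<b} = (\<lambda>a\<in>{..<b}. \<pi> a b y)"
    using homeomorphic_imp_surjective_map[OF limit_homeomorphic[OF assms(1,2)]] by blast
  have "\<pi> a b y = t a" if "a < b" for a
    using fun_cong[OF y(2), of a] that by simp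
  then show ?thesis using y(1) by blast
qed

lemma successor_fibres:
  assumes "a < b" "b = ord_succ a" "b \<le> \<delta>"
  obtains x where "x \<in> topspace (K a)" "\<pi> a b ` topspace (K b) = topspace (K a)"
    "\<And>u v. \<lbrakk>u \<in> topspace (K b); v \<in> topspace (K b); \<pi> a b u = \<pi> a b v; \<pi> a b u \<noteq> x\<rbrakk> \<Longrightarrow> u = v"
proof -
  have "simple_extension (K a) (K b) (\<pi> a b)"
    using system assms by (auto simp: system_of_simple_extensions_def)
  then obtain x where x: "x \<in> topspace (K a)" "card {z \<in> topspace (K b). \<pi> a b z = x} = 2"
      "\<And>y. y \<in> topspace (K a) - {x} \<Longrightarrow> card {z \<in> topspace (K b). \<pi> a b z = y} = 1"
    unfolding simple_extension_def by blast
  have "{z \<in> topspace (K b). \<pi> a b z = y} \<noteq> {}" if "y \<in> topspace (K a)" for y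
    using x(2) x(3)[of y] that by (cases "y = x") (metis card.empty zero_neq_numeral, force)
  then have "topspace (K a) \<subseteq> \<pi> a b ` topspace (K b)" by blast
  moreover have "\<pi> a b ` topspace (K b) \<subseteq> topspace (K a)"
    using assms bonding_in_topspace[of a b] by auto
  moreover have "u = v"
    if uv: "u \<in> topspace (K b)" "v \<in> topspace (K b)" "\<pi> a b u = \<pi> a b v" "\<pi> a b u \<noteq> x" for u v
  proof -
    have "\<pi> a b u \<in> topspace (K a) - {x}"
      using uv assms bonding_in_topspace[of a b] by auto
    then obtain w where "{z \<in> topspace (K b). \<pi> a b z = \<pi> a b u} = {w}"
      using x(3) card_1_singletonE by metis
    then have "u = w" "v = w" using uv by auto
    then show ?thesis by simp
  qed
  ultimately show thesis using x(1) that by blast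
qed

lemma to_cantor_comp:
  "\<lbrakk>a \<le> b; b \<le> \<delta>; x \<in> topspace (K b)\<rbrakk> \<Longrightarrow> to_cantor a (\<pi> a b x) = to_cantor b x"
  unfolding to_cantor_def by (simp add: bonding_comp ord_zero_le)

lemma to_cantor_continuous: "b \<le> \<delta> \<Longrightarrow> continuous_map (K b) cantor_space (to_cantor b)"
  using continuous_map_compose[OF bonding_continuous[of ord_zero b] homeomorphic_imp_continuous_map[OF h]]
  by (simp add: ord_zero_le o_def to_cantor_def[abs_def])

text \<open>
  At a limit \<open>b\<close> no thread over \<open>x\<close> is chosen step by step. Instead, the families that are
  threads up to \<open>a\<close> form a decreasing chain of closed sets in the compact product of the
  spaces below \<open>b\<close>, each nonempty because \<open>K a\<close> already maps onto \<open>K ord_zero\<close>; a common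
  element is a thread.
\<close>

lemma bonding_to_zero_onto:
  "b \<le> \<delta> \<Longrightarrow> x \<in> topspace (K ord_zero) \<Longrightarrow> \<exists>y\<in>topspace (K b). \<pi> ord_zero b y = x"
proof (induction b rule: less_induct)
  case (less b)
  show ?case
  proof (cases b rule: ordinal_cases)
    case zero
    then show ?thesis using less.prems bonding_id by blast
  next
    case (succ a)
    have a: "a \<le> b" "a \<le> \<delta>" using succ less.prems by auto
    obtain y where y: "y \<in> topspace (K a)" "\<pi> ord_zero a y = x"
      using less.IH[OF succ(1) a(2)] less.prems by blast
    obtain z where z: "z \<in> topspace (K b)" "\<pi> a b z = y"
      using successor_fibres[OF succ less.prems(1)] y(1) by (metis imageE)
    then show ?thesis
      using bonding_comp[OF ord_zero_le a(1) less.prems(1) z(1)] y(2) by auto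
  next
    case limit
    then have pos: "ord_zero < b"
      using ord_zero_le unfolding ord_limit_def by (metis order_le_less_trans)
    define P where "P = product_topology K {..<b}"
    define T where "T a = {t \<in> topspace P. t ord_zero = x} \<inter>
      (\<Inter>(c, c')\<in>{(c, c'). c \<le> c' \<and> c' \<le> a}. {t \<in> topspace P. \<pi> c c' (t c') = t c})" for a
    have proj: "continuous_map P (K a) (\<lambda>t. t a)" if "a < b" for a
      unfolding P_def using that by (intro continuous_map_product_projection) simp
    have "(\<Inter>a\<in>{..<b}. T a) \<noteq> {}"
    proof (rule compact_chain_nonempty_Inter)
      show "compact_space P"
        unfolding P_def using compact less.prems by (auto simp: compact_space_product_topology)
      show "{..<b} \<noteq> {}" using pos by blast
    next
      fix a assume a: "a \<in> {..<b}"
      have "closedin P {t \<in> topspace P. t ord_zero = x}"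
        using closedin_continuous_map_preimage[OF proj[OF pos], of "{x}"] less.prems
          Hausdorff[of ord_zero] ord_zero_le[of \<delta>] by (simp add: closedin_Hausdorff_singleton)
      moreover have "closedin P {t \<in> topspace P. \<pi> c c' (t c') = t c}" if c: "c \<le> c'" "c' \<le> a" for c c'
      proof (rule closedin_continuous_maps_eq)
        have le: "c' < b" "c < b" "c' \<le> \<delta>" "c \<le> \<delta>" using c a less.prems by auto
        show "Hausdorff_space (K c)" using Hausdorff le by blast
        show "continuous_map P (K c) (\<lambda>t. t c)" using proj le by blast
        show "continuous_map P (K c) (\<lambda>t. \<pi> c c' (t c'))"
          using continuous_map_compose[OF proj[OF le(1)] bonding_continuous[OF c(1) le(3)]]
          by (simp add: o_def)
      qed
      moreover have "(ord_zero, ord_zero) \<in> {(c, c'). c \<le> c' \<and> c' \<le> a}" by (simp add: ord_zero_le)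
      ultimately show "closedin P (T a)"
        unfolding T_def by (intro closedin_Int closedin_INT) auto
      have le: "a < b" "a \<le> \<delta>" using a less.prems by auto
      obtain y where y: "y \<in> topspace (K a)" "\<pi> ord_zero a y = x"
        using less.IH[OF le] less.prems by blast
      have "\<exists>p. p \<in> topspace (K c)" if "c < b" for c
        using less.IH[of c] that less.prems by (meson order.trans less_imp_le)
      then obtain p where p: "\<And>c. c < b \<Longrightarrow> p c \<in> topspace (K c)" by metis
      \<comment> \<open>Only the coordinates up to \<open>a\<close> are constrained; the others are filled in arbitrarily.\<close>
      define t where "t = (\<lambda>c\<in>{..<b}. if c \<le> a then \<pi> c a y else p c)"
      have "t \<in> topspace P"
        using bonding_in_topspace[of _ a y] y le p by (auto simp: P_def t_def)
      moreover have "t ord_zero = x"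
        using y pos by (simp add: t_def ord_zero_le)
      moreover have "\<pi> c c' (t c') = t c" if "c \<le> c'" "c' \<le> a" for c c'
      proof -
        have "c \<le> a" "c < b" "c' < b" using that le by auto
        then show ?thesis using that bonding_comp[OF that le(2) y(1)] by (simp add: t_def)
      qed
      ultimately have "t \<in> T a" by (auto simp: T_def)
      then show "T a \<noteq> {}" by blast
    next
      fix a a' :: 'i assume "a \<le> a'"
      then show "T a' \<subseteq> T a" unfolding T_def by fastforce
    qed
    then obtain t where t: "\<And>a. a < b \<Longrightarrow> t \<in> T a" by blast
    have "t ord_zero = x" "t \<in> topspace P" using t[OF pos] by (auto simp: T_def)
    moreover have "\<pi> c c' (t c') = t c" if "c \<le> c'" "c' < b" for c c'
      using t[OF that(2)] that by (auto simp: T_def)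
    ultimately obtain y where "y \<in> topspace (K b)" "\<forall>a<b. \<pi> a b y = t a"
      using limit_thread[OF less.prems(1) limit, of t] by (auto simp: P_def)
    then show ?thesis using pos \<open>t ord_zero = x\<close> by auto
  qed
qed

lemma to_cantor_onto:
  assumes "b \<le> \<delta>" shows "to_cantor b ` topspace (K b) = UNIV"
proof -
  have "s \<in> to_cantor b ` topspace (K b)" for s
  proof -
    obtain x where "x \<in> topspace (K ord_zero)" "h x = s"
      using homeomorphic_imp_surjective_map[OF h] by (metis UNIV_I imageE topspace_cantor_space)
    then show ?thesis
      using bonding_to_zero_onto[OF assms] by (force simp: to_cantor_def)
  qed
  then show ?thesis by blast
qed

text \<open>
  The invariant that transfinite induction carries through the system. Disjoint closed sets
  of a limit space already have disjoint images in an earlier space. At a successor the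
  images in the previous space can meet only in the single point \<open>x\<close> that is split, and they
  become disjoint once a cylinder around the image of \<open>x\<close> in the Cantor space is cut out;
  cylinders may be taken arbitrarily small.
\<close>

lemma negligible_overlap_to_cantor:
  "\<lbrakk>b \<le> \<delta>; closedin (K b) A; closedin (K b) B; A \<inter> B = {}\<rbrakk>
    \<Longrightarrow> negligible_overlap (to_cantor b ` A) (to_cantor b ` B)"
proof (induction b arbitrary: A B rule: less_induct)
  case (less b)
  have AB: "A \<subseteq> topspace (K b)" "B \<subseteq> topspace (K b)"
    using less.prems closedin_subset by blast+
  have push: "to_cantor a ` \<pi> a b ` C = to_cantor b ` C" if "a \<le> b" "C \<subseteq> topspace (K b)" for a C
    using to_cantor_comp[OF that(1) less.prems(1)] that(2)
    by (auto simp: image_image subset_iff intro!: image_cong)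
  show ?case
  proof (cases b rule: ordinal_cases)
    case zero
    have eq: "to_cantor b ` C = h ` C" if "C \<subseteq> topspace (K b)" for C
      using that bonding_id[of b] less.prems(1) zero
      by (intro image_cong) (auto simp: to_cantor_def)
    have "h ` A \<inter> h ` B = {}"
      using homeomorphic_imp_injective_map[OF h] AB less.prems(4) zero
      by (simp add: inj_on_image_Int[symmetric])
    moreover have "closedin cantor_space (h ` A)" "closedin cantor_space (h ` B)"
      using homeomorphic_imp_closed_map[OF h] less.prems(2,3) zero by (auto simp: closed_map_def)
    ultimately show ?thesis
      using eq AB by (simp add: negligible_overlap_closed_disjoint)
  next
    case (succ a)
    have a: "a \<le> b" "a \<le> \<delta>" using succ less.prems by auto
    obtain x where x: "x \<in> topspace (K a)"
      "\<And>u v. \<lbrakk>u \<in> topspace (K b); v \<in> topspace (K b); \<pi> a b u = \<pi> a b v; \<pi> a b u \<noteq> x\<rbrakk> \<Longrightarrow> u = v"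
      using successor_fibres[OF succ less.prems(1)] by metis
    show ?thesis
    proof (rule negligible_overlap_off_point)
      fix k
      define C where "C = {t. initial_word k t = initial_word k (to_cantor a x)}"
      define off where "off D = D \<inter> {u \<in> topspace (K b). to_cantor b u \<in> UNIV - C}" for D
      have "closedin cantor_space (UNIV - C)"
        using openin_cylinder[of k "to_cantor a x"] by (simp add: closedin_def C_def double_diff)
      then have closed: "closedin (K b) (off D)" if "closedin (K b) D" for D
        unfolding off_def using that
        by (intro closedin_Int closedin_continuous_map_preimage[OF to_cantor_continuous[OF less.prems(1)]])
      have "\<pi> a b ` off A \<inter> \<pi> a b ` off B = {}"
      proof (rule ccontr)
        assume "\<pi> a b ` off A \<inter> \<pi> a b ` off B \<noteq> {}"
        then obtain u v where uv: "u \<in> off A" "v \<in> off B" "\<pi> a b u = \<pi> a b v" by blast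
        then have top: "u \<in> topspace (K b)" "v \<in> topspace (K b)" by (auto simp: off_def)
        have "\<pi> a b u \<noteq> x"
          using to_cantor_comp[OF a(1) less.prems(1) top(1)] uv(1) by (auto simp: off_def C_def)
        then have "u = v" using x(2) top uv(3) by blast
        then show False using uv less.prems(4) by (auto simp: off_def)
      qed
      then have "negligible_overlap (to_cantor a ` \<pi> a b ` off A) (to_cantor a ` \<pi> a b ` off B)"
        using less.IH[OF succ(1) a(2)] bonding_closed[OF a(1) less.prems(1)] closed less.prems(2,3)
        by blast
      moreover have "to_cantor a ` \<pi> a b ` off D = to_cantor b ` D - C" if "D \<subseteq> topspace (K b)" for D
      proof -
        have "off D \<subseteq> topspace (K b)" by (auto simp: off_def)
        then have "to_cantor a ` \<pi> a b ` off D = to_cantor b ` off D" by (rule push[OF a(1)])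
        also have "\<dots> = to_cantor b ` D - C" using that by (auto simp: off_def)
        finally show ?thesis .
      qed
      ultimately show "negligible_overlap
          (to_cantor b ` A - {t. initial_word k t = initial_word k (to_cantor a x)})
          (to_cantor b ` B - {t. initial_word k t = initial_word k (to_cantor a x)})"
        using AB by (simp add: C_def)
    qed
  next
    case limit
    have "\<exists>a\<in>{..<b}. \<pi> a b ` A \<inter> \<pi> a b ` B = {}"
    proof (rule disjoint_closed_images_in_chain)
      show "compact_space (K b)" using compact less.prems by blast
      show "{..<b} \<noteq> {}" using limit by (auto simp: ord_limit_def)
    next
      fix a assume "a \<in> {..<b}"
      then have "a \<le> b" "a \<le> \<delta>" using less.prems(1) by auto
      then show "Hausdorff_space (K a)" "continuous_map (K b) (K a) (\<pi> a b)"
        using Hausdorff bonding_continuous less.prems(1) by auto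
    next
      fix a a' x y
      assume "a' \<in> {..<b}" "a \<le> a'" "x \<in> topspace (K b)" "y \<in> topspace (K b)" "\<pi> a' b x = \<pi> a' b y"
      then show "\<pi> a b x = \<pi> a b y"
        using bonding_comp[of a a' b] less.prems(1) by (metis lessThan_iff less_imp_le)
    next
      fix x y
      assume "x \<in> topspace (K b)" "y \<in> topspace (K b)" "\<And>a. a \<in> {..<b} \<Longrightarrow> \<pi> a b x = \<pi> a b y"
      then show "x = y" using limit_separating[OF less.prems(1) limit] by simp
    qed (use less.prems in blast)+
    then obtain a where a: "a < b" "\<pi> a b ` A \<inter> \<pi> a b ` B = {}" by blast
    then have "a \<le> b" "a \<le> \<delta>" using less.prems(1) by auto
    then have "negligible_overlap (to_cantor a ` \<pi> a b ` A) (to_cantor a ` \<pi> a b ` B)"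
      using less.IH[OF a(1) _ _ _ a(2)] bonding_closed less.prems by blast
    then show ?thesis using push[OF \<open>a \<le> b\<close>] AB by simp
  qed
qed

end

theorem theorem9p10:
  fixes \<delta> :: "'i::wellorder"
    and K :: "'i \<Rightarrow> 'a topology"
    and \<pi> :: "'i \<Rightarrow> 'i \<Rightarrow> 'a \<Rightarrow> 'a"
  assumes "system_of_simple_extensions \<delta> K \<pi>"
  shows "fsJNP (K \<delta>)"
proof -
  have "K ord_zero homeomorphic_space cantor_space"
    using assms by (simp add: system_of_simple_extensions_def)
  then obtain h where "homeomorphic_map (K ord_zero) cantor_space h"
    using homeomorphic_space by blast
  then interpret simple_extension_system \<delta> K \<pi> h
    using assms by unfold_locales
  show ?thesis
  proof (rule fsJNP_if_negligible_overlaps)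
    show "to_cantor \<delta> ` topspace (K \<delta>) = UNIV" by (rule to_cantor_onto) simp
    show "negligible_overlap (to_cantor \<delta> ` A) (to_cantor \<delta> ` B)"
      if "closedin (K \<delta>) A" "closedin (K \<delta>) B" "A \<inter> B = {}" for A B
      using negligible_overlap_to_cantor[OF order_refl that] .
  qed (simp_all add: compact Hausdorff)
qed

end
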